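(* Let $f_1,\dots,f_m$ be Lipschitz maps of $\mathbb{R}^d$, let $\overline p=(p_1,\dots,p_m)$ be a probability vector, and suppose that the iterated function system $\Phi=(\{f_i\},\overline p)$ contracts on average, with Lyapunov exponent $\chi(\Phi)<0$ and stationary measure $\mu$. Let $h(\overline p)=\sum_{i=1}^m p_i\log p_i$. If $$d\,|\chi(\Phi)|>|h(\overline p)|,$$ then $\mu$ is singular with respect to Lebesgue measure on $\mathbb{R}^d$, and moreover $$\dim_H(\mu)\le\frac{h(\overline p)}{\chi(\Phi)}<d.$$
   Context: Setting. $f_1,\dots,f_m:\mathbb{R}^d\to\mathbb{R}^d$ are Lipschitz maps, $\overline p=(p_1,\dots,p_m)$ is a probability vector (with $0\log 0=0$), $\Omega=\prod_0^\infty\{1,\dots,m\}$, and $\nu$ is the product (Bernoulli) probability measure on $\Omega$ induced by $\overline p$. For a Lipschitz map $g$ of $\mathbb{R}^d$, $\|g\|$ denotes its Lipschitz constant. Contraction on average. $\Phi$ contracts on average if there is a real number $\chi(\Phi)<0$ (the Lyapunov exponent) such that for $\nu$-a.e. $\omega\in\Omega$, $$\lim_{n\to\infty}\tfrac1n\log\|f_{\omega_0}\circ\dots\circ f_{\omega_{n-1}}\|=\chi(\Phi).$$ Stationary measure. Under contraction on average, for $\nu$-a.e. $\omega$ the limit $\phi(\omega)=\lim_{n\to\infty}f_{\omega_0}\circ\dots\circ f_{\omega_{n-1}}(x_0)$ exists and does not depend on $x_0\in\mathbb{R}^d$; $\mu=\nu\circ\phi^{-1}$ is the unique stationary Borel probability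 measure on $\mathbb{R}^d$, i.e. $\mu(B)=\sum_{i=1}^m p_i\,\mu(f_i^{-1}B)$ for all Borel $B$. Hausdorff dimension of a measure. $\dim_H(\mu)=\mu\text{-}\operatorname{ess\,sup}_x\ \liminf_{r\to0}\frac{\log\mu(B(x,r))}{\log r}$, where $B(x,r)$ is the ball of radius $r$ about $x$. *)

theory Defs
  imports "HOL-Probability.Probability"
begin

text \<open>Logarithm of a nonnegative real with the convention \<open>log 0 = -\<infinity>\<close>
  (the library has \<open>ln 0 = 0\<close>).\<close>

definition elog :: "real \<Rightarrow> ereal" where
  "elog x = (if x = 0 then -\<infinity> else ereal (ln x))"

definition lipschitz_map :: "('a::metric_space \<Rightarrow> 'b::metric_space) \<Rightarrow> bool" where
  "lipschitz_map g \<longleftrightarrow> (\<exists>L. L-lipschitz_on UNIV g)"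

definition lipschitz_norm :: "('a::metric_space \<Rightarrow> 'b::metric_space) \<Rightarrow> real" where
  "lipschitz_norm g = Inf {L. L-lipschitz_on UNIV g}"

definition prob_vector :: "nat \<Rightarrow> (nat \<Rightarrow> real) \<Rightarrow> bool" where
  "prob_vector m p \<longleftrightarrow> (\<forall>i\<in>{1..m}. 0 \<le> p i) \<and> (\<Sum>i=1..m. p i) = 1"

text \<open>The sum \<open>h(p)\<close> carries no minus sign, so it is nonpositive;
  \<open>0 * ln 0 = 0\<close> holds in the library.\<close>

definition h_vector :: "nat \<Rightarrow> (nat \<Rightarrow> real) \<Rightarrow> real" where
  "h_vector m p = (\<Sum>i=1..m. p i * ln (p i))"

definition bernoulli_measure :: "nat \<Rightarrow> (nat \<Rightarrow> real) \<Rightarrow> (nat \<Rightarrow> nat) measure" where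
  "bernoulli_measure m p = PiM UNIV (\<lambda>_. point_measure {1..m} (\<lambda>i. ennreal (p i)))"

text \<open>\<open>word_map f \<omega> n = f (\<omega> 0) \<circ> \<dots> \<circ> f (\<omega> (n - 1))\<close>: the newest map is applied first.\<close>

primrec word_map :: "(nat \<Rightarrow> 'a \<Rightarrow> 'a) \<Rightarrow> (nat \<Rightarrow> nat) \<Rightarrow> nat \<Rightarrow> 'a \<Rightarrow> 'a" where
  "word_map f \<omega> 0 = id"
| "word_map f \<omega> (Suc n) = word_map f \<omega> n \<circ> f (\<omega> n)"

definition contracts_on_average ::
  "nat \<Rightarrow> (nat \<Rightarrow> 'a::metric_space \<Rightarrow> 'a) \<Rightarrow> (nat \<Rightarrow> real) \<Rightarrow> real \<Rightarrow> bool" where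
  "contracts_on_average m f p lyap \<longleftrightarrow> lyap < 0 \<and>
     (AE \<omega> in bernoulli_measure m p.
        (\<lambda>n. elog (lipschitz_norm (word_map f \<omega> n)) / ereal (real n)) \<longlonglongrightarrow> ereal lyap)"

definition stationary_measure ::
  "nat \<Rightarrow> (nat \<Rightarrow> 'a::topological_space \<Rightarrow> 'a) \<Rightarrow> (nat \<Rightarrow> real) \<Rightarrow> 'a measure \<Rightarrow> bool" where
  "stationary_measure m f p \<mu> \<longleftrightarrow> prob_space \<mu> \<and> sets \<mu> = sets borel \<and>
     (\<forall>B\<in>sets borel. emeasure \<mu> B = (\<Sum>i=1..m. ennreal (p i) * emeasure \<mu> (f i -` B)))"

definition mutually_singular :: "'a measure \<Rightarrow> 'a measure \<Rightarrow> bool" where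
  "mutually_singular M N \<longleftrightarrow>
     (\<exists>A\<in>sets M \<inter> sets N. emeasure M A = 0 \<and> emeasure N (space N - A) = 0)"

definition lower_local_dim :: "'a::metric_space measure \<Rightarrow> 'a \<Rightarrow> ereal" where
  "lower_local_dim \<mu> x = Liminf (at_right 0) (\<lambda>r. elog (measure \<mu> (ball x r)) / ereal (ln r))"

definition dim_H :: "'a::metric_space measure \<Rightarrow> ereal" where
  "dim_H \<mu> = esssup \<mu> (lower_local_dim \<mu>)"

end

theory Submission
  imports Defs
begin

text \<open>Call a word \<open>w\<close> of length \<open>n\<close> good if \<open>\<parallel>f\<^sub>w\<parallel> \<le> e\<^bsup>n(\<chi>+\<epsilon>)\<^esup>\<close> and \<open>p\<^sub>w \<ge> e\<^bsup>n(h-\<epsilon>)\<^esup>\<close>; contraction on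
  average and Hoeffding's inequality show that the good words carry \<open>p\<close>-mass tending to 1.
  By iterated stationarity, the union \<open>T\<^sub>n\<close> of the images \<open>f\<^sub>w(B(0,R))\<close> over good \<open>w\<close> has
  \<open>\<mu>\<close>-measure at least \<open>(1 - o(1)) \<mu>(B(0,R))\<close>, so \<open>\<mu>\<close>-almost every point lies, for some \<open>R\<close>, in
  infinitely many \<open>T\<^sub>n\<close>. At such a point the ball of radius \<open>(2R+1) e\<^bsup>n(\<chi>+\<epsilon>)\<^esup>\<close> contains a whole
  image and so has measure at least \<open>e\<^bsup>n(h-\<epsilon>)\<^esup> \<mu>(B(0,R))\<close>, which bounds the local dimension by
  \<open>(h-\<epsilon>)/(\<chi>+\<epsilon>)\<close>. There are at most \<open>e\<^bsup>-n(h-\<epsilon>)\<^esup>\<close> good words, so the Lebesgue measure of \<open>T\<^sub>n\<close> is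
  \<open>O(e\<^bsup>n(d(\<chi>+\<epsilon>)-h+\<epsilon>)\<^esup>)\<close>, and Borel--Cantelli makes \<open>limsup T\<^sub>n\<close> a Lebesgue null set.\<close>

section \<open>Lipschitz constants of compositions\<close>

text \<open>The infimum is attained: for \<open>x \<noteq> y\<close> the ratio
  \<open>dist (g x) (g y) / dist x y\<close> is a lower bound of the set of Lipschitz constants, so
  it is at most their infimum.\<close>

lemma lipschitz_norm_lipschitz_on:
  assumes "lipschitz_map g"
  shows "(lipschitz_norm g)-lipschitz_on UNIV g"
proof -
  define S where "S = {L. L-lipschitz_on UNIV g}"
  have ne: "S \<noteq> {}" using assms by (auto simp: S_def lipschitz_map_def)
  have nn: "0 \<le> L" if "L \<in> S" for L using that by (auto simp: S_def lipschitz_on_def)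
  show ?thesis
  proof (rule lipschitz_onI)
    show "0 \<le> lipschitz_norm g"
      unfolding lipschitz_norm_def S_def[symmetric] using ne nn by (intro cInf_greatest) auto
    fix x y
    show "dist (g x) (g y) \<le> lipschitz_norm g * dist x y"
    proof (cases "x = y")
      case False
      have "dist (g x) (g y) / dist x y \<le> Inf S"
        using ne False by (intro cInf_greatest) (auto simp: S_def lipschitz_on_def field_simps)
      then show ?thesis
        using False by (simp add: lipschitz_norm_def S_def[symmetric] field_simps)
    qed simp
  qed
qed

lemma lipschitz_map_comp:
  "lipschitz_map f \<Longrightarrow> lipschitz_map g \<Longrightarrow> lipschitz_map (f \<circ> g)"
  unfolding lipschitz_map_def
  by (metis lipschitz_on_compose lipschitz_on_subset subset_UNIV)

lemma lipschitz_map_continuous_on: "lipschitz_map f \<Longrightarrow> continuous_on UNIV f"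
  unfolding lipschitz_map_def by (auto intro: lipschitz_on_continuous_on)

lemma lipschitz_map_word_map:
  assumes "\<And>i. i < n \<Longrightarrow> lipschitz_map (f (w i))"
  shows "lipschitz_map (word_map f w n)"
  using assms
proof (induction n)
  case 0
  have "1-lipschitz_on UNIV (id :: 'a \<Rightarrow> 'a)" by (intro lipschitz_onI) auto
  then show ?case by (auto simp: lipschitz_map_def)
qed (simp add: lipschitz_map_comp)

lemma word_map_cong:
  "(\<And>i. i < n \<Longrightarrow> v i = w i) \<Longrightarrow> word_map f v n = word_map f w n"
  by (induction n) auto

section \<open>Finite words, their weights and iterated stationarity\<close>

text \<open>Extensional functions give each word a single representative and make the set finite. An
  infinite sequence yields its prefix by \<open>restrict\<close>.\<close>

definition words :: "nat \<Rightarrow> nat \<Rightarrow> (nat \<Rightarrow> nat) set" where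
  "words m n = {..<n} \<rightarrow>\<^sub>E {1..m}"

definition word_weight :: "(nat \<Rightarrow> real) \<Rightarrow> (nat \<Rightarrow> nat) \<Rightarrow> nat \<Rightarrow> real" where
  "word_weight p w n = (\<Prod>i<n. p (w i))"

lemma finite_words [simp]: "finite (words m n)"
  by (auto simp: words_def intro!: finite_PiE)

lemma words_letter: "w \<in> words m n \<Longrightarrow> i < n \<Longrightarrow> w i \<in> {1..m}"
  by (auto simp: words_def PiE_iff)

lemma restrict_in_words: "(\<And>i. i < n \<Longrightarrow> \<omega> i \<in> {1..m}) \<Longrightarrow> restrict \<omega> {..<n} \<in> words m n"
  by (auto simp: words_def)

lemma sum_words_Suc:
  fixes g :: "(nat \<Rightarrow> nat) \<Rightarrow> 'b::comm_monoid_add"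
  shows "(\<Sum>w\<in>words m (Suc n). g w) = (\<Sum>w\<in>words m n. \<Sum>i=1..m. g (w(n := i)))"
proof -
  have eq: "words m (Suc n) = (\<lambda>(i, w). w(n := i)) ` ({1..m} \<times> words m n)"
    unfolding words_def lessThan_Suc by (rule PiE_insert_eq)
  have inj: "inj_on (\<lambda>(i, w). w(n := i)) ({1..m} \<times> words m n)"
    unfolding words_def by (rule inj_combinator) simp
  show ?thesis
    unfolding eq by (subst sum.reindex[OF inj], subst sum.swap)
      (simp add: sum.cartesian_product case_prod_unfold)
qed

lemma prob_vector_nonneg: "prob_vector m p \<Longrightarrow> i \<in> {1..m} \<Longrightarrow> 0 \<le> p i"
  by (auto simp: prob_vector_def)

lemma prob_vector_le_1:
  assumes "prob_vector m p" "i \<in> {1..m}" shows "p i \<le> 1"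
proof -
  have "p i \<le> (\<Sum>i=1..m. p i)"
    using assms by (intro member_le_sum) (auto simp: prob_vector_def)
  then show ?thesis using assms by (simp add: prob_vector_def)
qed

lemma h_vector_nonpos:
  assumes "prob_vector m p" shows "h_vector m p \<le> 0"
  unfolding h_vector_def
proof (intro sum_nonpos)
  fix i assume "i \<in> {1..m}"
  then have "0 \<le> p i" "p i \<le> 1"
    using assms prob_vector_nonneg prob_vector_le_1 by auto
  then show "p i * ln (p i) \<le> 0"
    by (cases "p i = 0") (auto intro!: mult_nonneg_nonpos)
qed

lemma word_weight_nonneg:
  "prob_vector m p \<Longrightarrow> w \<in> words m n \<Longrightarrow> 0 \<le> word_weight p w n"
  unfolding word_weight_def
  by (intro prod_nonneg) (auto intro: prob_vector_nonneg words_letter)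

text \<open>Induction on the length. The newest map is applied first, so lengthening a word by
  \<open>i\<close> takes one more preimage under \<open>f i\<close>; stationarity, applied to the
  preimage of \<open>B\<close> under the old word, splits its measure over \<open>i\<close>.\<close>

lemma stationary_measure_word_map:
  fixes f :: "nat \<Rightarrow> 'a::metric_space \<Rightarrow> 'a"
  assumes lip: "\<And>i. i \<in> {1..m} \<Longrightarrow> lipschitz_map (f i)"
    and p: "prob_vector m p"
    and st: "stationary_measure m f p \<mu>"
    and B: "B \<in> sets borel"
  shows "emeasure \<mu> B =
    (\<Sum>w\<in>words m n. ennreal (word_weight p w n) * emeasure \<mu> (word_map f w n -` B))"
proof (induction n)
  case 0
  have "words m 0 = {\<lambda>_. undefined}" by (simp add: words_def)
  then show ?case by (simp add: word_weight_def)
next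
  case (Suc n)
  have "ennreal (word_weight p w n) * emeasure \<mu> (word_map f w n -` B) =
      (\<Sum>i=1..m. ennreal (word_weight p (w(n := i)) (Suc n)) *
        emeasure \<mu> (word_map f (w(n := i)) (Suc n) -` B))" if w: "w \<in> words m n" for w
  proof -
    have "word_map f w n \<in> borel_measurable borel"
      by (intro borel_measurable_continuous_onI lipschitz_map_continuous_on
          lipschitz_map_word_map lip words_letter[OF w])
    from measurable_sets[OF this B] have "word_map f w n -` B \<in> sets borel" by simp
    then have "emeasure \<mu> (word_map f w n -` B) =
      (\<Sum>i=1..m. ennreal (p i) * emeasure \<mu> (f i -` (word_map f w n -` B)))"
      using st by (simp add: stationary_measure_def)
    moreover have "word_map f (w(n := i)) (Suc n) -` B = f i -` (word_map f w n -` B)" for i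
      using word_map_cong[of n "w(n := i)" w f] by auto
    moreover have "ennreal (word_weight p (w(n := i)) (Suc n)) =
        ennreal (word_weight p w n) * ennreal (p i)" if "i \<in> {1..m}" for i
      using word_weight_nonneg[OF p w] prob_vector_nonneg[OF p that]
      by (simp add: word_weight_def ennreal_mult)
    ultimately show ?thesis
      by (simp add: sum_distrib_left mult.assoc del: word_map.simps)
  qed
  then show ?case
    by (subst Suc.IH, subst sum_words_Suc) (rule sum.cong, auto)
qed

section \<open>The Bernoulli measure: cylinders, independence, concentration\<close>

lemma prob_space_point_measure_vector:
  assumes "prob_vector m p"
  shows "prob_space (point_measure {1..m} (\<lambda>i. ennreal (p i)))"
proof
  have "emeasure (point_measure {1..m} (\<lambda>i. ennreal (p i))) {1..m} = (\<Sum>i=1..m. ennreal (p i))"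
    by (rule emeasure_point_measure_finite) auto
  also have "\<dots> = ennreal (\<Sum>i=1..m. p i)"
    using assms by (intro sum_ennreal) (auto simp: prob_vector_def)
  also have "\<dots> = 1" using assms by (simp add: prob_vector_def)
  finally show "emeasure (point_measure {1..m} (\<lambda>i. ennreal (p i)))
      (space (point_measure {1..m} (\<lambda>i. ennreal (p i)))) = 1"
    by (simp add: space_point_measure)
qed

lemma prob_space_bernoulli_measure:
  "prob_vector m p \<Longrightarrow> prob_space (bernoulli_measure m p)"
  unfolding bernoulli_measure_def
  by (intro prob_space_PiM prob_space_point_measure_vector)

lemma space_bernoulli_measure:
  "space (bernoulli_measure m p) = (\<Pi> _\<in>UNIV. {1..m})"
  by (auto simp: bernoulli_measure_def space_PiM space_point_measure)

text \<open>Such an event is a finite disjoint union of cylinders, and a cylinder has the product of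
  its letter probabilities as mass. This turns probabilities of prefix events into sums over words
  and back.\<close>

lemma bernoulli_measure_word_event:
  assumes p: "prob_vector m p" and S: "S \<subseteq> words m n"
  shows "{\<omega> \<in> space (bernoulli_measure m p). restrict \<omega> {..<n} \<in> S} \<in> sets (bernoulli_measure m p)"
    and "measure (bernoulli_measure m p) {\<omega> \<in> space (bernoulli_measure m p). restrict \<omega> {..<n} \<in> S} =
      (\<Sum>w\<in>S. word_weight p w n)"
proof -
  let ?\<nu> = "bernoulli_measure m p" and ?P = "point_measure {1..m} (\<lambda>i. ennreal (p i))"
  interpret \<nu>: prob_space ?\<nu> by (rule prob_space_bernoulli_measure[OF p])
  let ?C = "\<lambda>w. {\<omega> \<in> space ?\<nu>. restrict \<omega> {..<n} = w}"
  have C: "?C w \<in> sets ?\<nu> \<and> measure ?\<nu> (?C w) = word_weight p w n" if w: "w \<in> words m n" for w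
  proof -
    have let_w: "w i \<in> {1..m}" if "i < n" for i using words_letter[OF w that] .
    have eq: "?C w = prod_emb UNIV (\<lambda>_. ?P) {..<n} (\<Pi>\<^sub>E i\<in>{..<n}. {w i})"
      using w by (auto simp: prod_emb_def bernoulli_measure_def space_PiM words_def PiE_iff
          fun_eq_iff extensional_def restrict_def)
    have "emeasure ?\<nu> (?C w) = (\<Prod>i<n. emeasure ?P {w i})"
      unfolding eq unfolding bernoulli_measure_def using let_w
      by (intro emeasure_PiM_emb prob_space_point_measure_vector[OF p])
         (auto simp: sets_point_measure)
    also have "\<dots> = (\<Prod>i<n. ennreal (p (w i)))"
      using let_w by (intro prod.cong) (auto simp: emeasure_point_measure_finite)
    also have "\<dots> = ennreal (word_weight p w n)"
      unfolding word_weight_def using let_w p by (intro prod_ennreal) (auto intro: prob_vector_nonneg)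
    finally have "emeasure ?\<nu> (?C w) = ennreal (word_weight p w n)" .
    moreover have "?C w \<in> sets ?\<nu>"
      unfolding eq unfolding bernoulli_measure_def using let_w
      by (intro sets_PiM_I) (auto simp: sets_point_measure)
    ultimately show ?thesis
      using word_weight_nonneg[OF p w] by (simp add: measure_def)
  qed
  have fin: "finite S" using S by (rule finite_subset) simp
  have eq: "{\<omega> \<in> space ?\<nu>. restrict \<omega> {..<n} \<in> S} = (\<Union>w\<in>S. ?C w)" by auto
  show "{\<omega> \<in> space ?\<nu>. restrict \<omega> {..<n} \<in> S} \<in> sets ?\<nu>"
    unfolding eq using C S fin by (intro sets.finite_UN) auto
  have "measure ?\<nu> (\<Union>w\<in>S. ?C w) = (\<Sum>w\<in>S. measure ?\<nu> (?C w))"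
    using C S fin by (intro \<nu>.finite_measure_finite_Union) (auto simp: disjoint_family_on_def)
  then show "measure ?\<nu> {\<omega> \<in> space ?\<nu>. restrict \<omega> {..<n} \<in> S} = (\<Sum>w\<in>S. word_weight p w n)"
    unfolding eq using C S by (auto intro!: sum.cong)
qed

text \<open>The joint law of the first \<open>n\<close> coordinates is the finite product measure,
  which is the product of their individual laws.\<close>

lemma bernoulli_measure_coordinate_indep:
  assumes p: "prob_vector m p" and n: "n > 0"
  shows "prob_space.indep_vars (bernoulli_measure m p) (\<lambda>_. point_measure {1..m} (\<lambda>i. ennreal (p i)))
    (\<lambda>i \<omega>. \<omega> i) {..<n}"
proof -
  let ?P = "point_measure {1..m} (\<lambda>i. ennreal (p i))"
  interpret P: prob_space ?P by (rule prob_space_point_measure_vector[OF p])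
  interpret PP: product_prob_space "\<lambda>_::nat. ?P" UNIV by unfold_locales
  have comp: "distr (PiM UNIV (\<lambda>_. ?P)) ?P (\<lambda>\<omega>. \<omega> i) = ?P" for i :: nat
    by (rule PP.PiM_component) simp
  have "distr (PiM UNIV (\<lambda>_. ?P)) (PiM {..<n} (\<lambda>_. ?P)) (\<lambda>x. restrict x {..<n}) = PiM {..<n} (\<lambda>_. ?P)"
    by (rule PP.distr_PiM_restrict_finite) auto
  moreover have "(\<Pi>\<^sub>M i\<in>{..<n}. distr (PiM UNIV (\<lambda>_. ?P)) ?P (\<lambda>\<omega>. \<omega> i)) = PiM {..<n} (\<lambda>_. ?P)"
    by (intro PiM_cong comp) auto
  moreover have "(\<lambda>\<omega>. \<omega> i) \<in> measurable (PiM UNIV (\<lambda>_. ?P)) ?P" for i :: nat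
    by (rule measurable_component_singleton) simp
  ultimately show ?thesis
    unfolding bernoulli_measure_def using n
    by (subst PP.indep_vars_iff_distr_eq_PiM') (simp_all del: One_nat_def measurable_point_measure_eq2_finite, auto)
qed

text \<open>The variables \<open>ln (p (\<omega> i))\<close> are independent, bounded and of mean
  \<open>h_vector m p\<close>, so Hoeffding's inequality bounds the probability by an exponentially
  decaying sequence.\<close>

lemma bernoulli_measure_log_weight_deviation:
  assumes p: "prob_vector m p" and e: "e > 0"
  shows "(\<lambda>n. measure (bernoulli_measure m p)
     {\<omega> \<in> space (bernoulli_measure m p). (\<Sum>i<n. ln (p (\<omega> i))) \<le> real n * (h_vector m p - e)})
     \<longlonglongrightarrow> 0"
proof -
  let ?\<nu> = "bernoulli_measure m p" and ?P = "point_measure {1..m} (\<lambda>i. ennreal (p i))"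
  interpret \<nu>: prob_space ?\<nu> by (rule prob_space_bernoulli_measure[OF p])
  interpret P: prob_space ?P by (rule prob_space_point_measure_vector[OF p])
  interpret PP: product_prob_space "\<lambda>_::nat. ?P" UNIV by unfold_locales
  \<comment> \<open>The summand 1 keeps \<open>b\<close> positive even if all logarithms vanish, as
    the denominator in Hoeffding's bound requires. A letter of probability zero contributes
    \<open>ln 0 = 0\<close>.\<close>
  define b where "b = 1 + (\<Sum>i=1..m. \<bar>ln (p i)\<bar>)"
  have b_pos: "b > 0" unfolding b_def by (intro add_pos_nonneg sum_nonneg) auto
  have bound: "\<bar>ln (p i)\<bar> \<le> b" if "i \<in> {1..m}" for i
    unfolding b_def using member_le_sum[of i "{1..m}" "\<lambda>i. \<bar>ln (p i)\<bar>"] that by auto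
  have mean: "\<nu>.expectation (\<lambda>\<omega>. ln (p (\<omega> i))) = h_vector m p" for i
  proof -
    have "h_vector m p = (\<integral>x. ln (p x) \<partial>?P)"
      using p by (subst lebesgue_integral_point_measure_finite)
        (auto simp: h_vector_def prob_vector_def)
    also have "\<dots> = (\<integral>x. ln (p x) \<partial>distr (PiM UNIV (\<lambda>_. ?P)) ?P (\<lambda>\<omega>. \<omega> i))"
      by (subst PP.PiM_component) auto
    also have "\<dots> = (\<integral>\<omega>. ln (p (\<omega> i)) \<partial>?\<nu>)"
      unfolding bernoulli_measure_def
      by (rule integral_distr[OF measurable_component_singleton]) auto
    finally show ?thesis by simp
  qed
  have le: "measure ?\<nu> {\<omega> \<in> space ?\<nu>. (\<Sum>i<n. ln (p (\<omega> i))) \<le> real n * (h_vector m p - e)}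
     \<le> exp (- (e\<^sup>2 / (2 * b\<^sup>2)) * real n)" if n: "n > 0" for n
  proof -
    interpret H: Hoeffding_ineq ?\<nu> "{..<n}" "\<lambda>i \<omega>. ln (p (\<omega> i))" "\<lambda>_. - b" "\<lambda>_. b"
      "\<Sum>i<n. \<nu>.expectation (\<lambda>\<omega>. ln (p (\<omega> i)))"
    proof unfold_locales
      show "\<nu>.indep_vars (\<lambda>_. borel) (\<lambda>i \<omega>. ln (p (\<omega> i))) {..<n}"
        by (rule \<nu>.indep_vars_compose2[OF bernoulli_measure_coordinate_indep[OF p n]]) simp
      fix i :: nat
      show "AE \<omega> in ?\<nu>. ln (p (\<omega> i)) \<in> {- b..b}"
      proof (rule AE_I2)
        fix \<omega> assume "\<omega> \<in> space ?\<nu>"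
        then have "\<omega> i \<in> {1..m}" by (auto simp: space_bernoulli_measure)
        from bound[OF this] show "ln (p (\<omega> i)) \<in> {- b..b}" by auto
      qed
    qed auto
    have "(\<Sum>i<n. (b - - b)\<^sup>2) > 0" using n b_pos by simp
    from H.Hoeffding_ineq_le[OF _ this, of "real n * e"] e
    have "measure ?\<nu> {\<omega> \<in> space ?\<nu>. (\<Sum>i<n. ln (p (\<omega> i))) \<le> real n * h_vector m p - real n * e}
      \<le> exp (- 2 * (real n * e)\<^sup>2 / (real n * (b - - b)\<^sup>2))"
      by (simp add: mean)
    also have "- 2 * (real n * e)\<^sup>2 / (real n * (b - - b)\<^sup>2) = - (e\<^sup>2 / (2 * b\<^sup>2)) * real n"
      using n b_pos by (simp add: field_simps power2_eq_square)
    finally show ?thesis by (simp add: algebra_simps)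
  qed
  have "(\<lambda>n. exp (- (e\<^sup>2 / (2 * b\<^sup>2))) ^ n) \<longlonglongrightarrow> 0"
    using e b_pos by (intro LIMSEQ_power_zero) auto
  then have lim: "(\<lambda>n. exp (- (e\<^sup>2 / (2 * b\<^sup>2)) * real n)) \<longlonglongrightarrow> 0"
    by (simp add: exp_of_nat2_mult mult.commute flip: exp_of_nat_mult)
  show ?thesis
    by (rule tendsto_sandwich[OF _ eventually_sequentiallyI[of 1, OF le] tendsto_const lim]) auto
qed

section \<open>Good words\<close>

text \<open>In the applications \<open>a\<close> lies slightly above the Lyapunov exponent and
  \<open>b\<close> slightly below \<open>h_vector m p\<close>. The lower bound on the weight is
  positive, so a good word has no letter of probability zero.\<close>

definition good_words ::
  "nat \<Rightarrow> (nat \<Rightarrow> 'a::metric_space \<Rightarrow> 'a) \<Rightarrow> (nat \<Rightarrow> real) \<Rightarrow> real \<Rightarrow> real \<Rightarrow> nat \<Rightarrow> (nat \<Rightarrow> nat) set"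
  where "good_words m f p a b n = {w \<in> words m n.
    lipschitz_norm (word_map f w n) \<le> exp (real n * a) \<and> exp (real n * b) \<le> word_weight p w n}"

lemma good_words_subset: "good_words m f p a b n \<subseteq> words m n"
  by (auto simp: good_words_def)

lemma finite_good_words [simp]: "finite (good_words m f p a b n)"
  by (rule finite_subset[OF good_words_subset finite_words])

text \<open>Almost sure convergence implies convergence in probability: almost every sequence
  eventually lies in the events, so dominated convergence applies to their indicators. Measurability
  comes from the dependence on finitely many letters.\<close>

lemma contracts_on_average_prob_tendsto:
  assumes p: "prob_vector m p" and con: "contracts_on_average m f p lyap" and a: "lyap < a"
  shows "(\<lambda>n. measure (bernoulli_measure m p) {\<omega> \<in> space (bernoulli_measure m p).
      restrict \<omega> {..<n} \<in> {w \<in> words m n. lipschitz_norm (word_map f w n) \<le> exp (real n * a)}})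
    \<longlonglongrightarrow> 1"
proof -
  let ?\<nu> = "bernoulli_measure m p"
  interpret \<nu>: prob_space ?\<nu> by (rule prob_space_bernoulli_measure[OF p])
  define A where "A n = {\<omega> \<in> space ?\<nu>.
      restrict \<omega> {..<n} \<in> {w \<in> words m n. lipschitz_norm (word_map f w n) \<le> exp (real n * a)}}" for n
  have [measurable]: "A n \<in> sets ?\<nu>" for n
    unfolding A_def by (intro bernoulli_measure_word_event(1)[OF p]) auto
  have ev: "AE \<omega> in ?\<nu>. eventually (\<lambda>n. \<omega> \<in> A n) sequentially"
  proof -
    have "AE \<omega> in ?\<nu>. (\<lambda>n. elog (lipschitz_norm (word_map f \<omega> n)) / ereal (real n)) \<longlonglongrightarrow> ereal lyap"
      using con by (simp add: contracts_on_average_def)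
    then show ?thesis
    proof (rule AE_mp, intro AE_I2 impI)
      fix \<omega> assume \<omega>: "\<omega> \<in> space ?\<nu>"
        and "(\<lambda>n. elog (lipschitz_norm (word_map f \<omega> n)) / ereal (real n)) \<longlonglongrightarrow> ereal lyap"
      then have "eventually (\<lambda>n. elog (lipschitz_norm (word_map f \<omega> n)) / ereal (real n) < ereal a) sequentially"
        using a by (intro order_tendstoD(2)) auto
      then show "eventually (\<lambda>n. \<omega> \<in> A n) sequentially"
        using eventually_gt_at_top[of 0]
      proof eventually_elim
        case (elim n)
        let ?L = "lipschitz_norm (word_map f \<omega> n)"
        have "?L \<le> exp (real n * a)"
        \<comment> \<open>A vanishing norm, where \<open>elog\<close> is minus infinity, satisfies
          the bound trivially; otherwise \<open>elog\<close> is the real logarithm.\<close>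
        proof (cases "?L \<le> 0")
          case True then show ?thesis using exp_gt_zero[of "real n * a"] by linarith
        next
          case False
          then have "ln ?L / real n < a" using elim by (simp add: elog_def)
          then have "ln ?L < real n * a" using elim by (simp add: field_simps)
          then show ?thesis using False by (metis exp_le_cancel_iff exp_ln less_imp_le not_le)
        qed
        moreover have "restrict \<omega> {..<n} \<in> words m n"
          using \<omega> by (intro restrict_in_words) (auto simp: space_bernoulli_measure)
        moreover have "word_map f (restrict \<omega> {..<n}) n = word_map f \<omega> n"
          by (rule word_map_cong) simp
        ultimately show ?case using \<omega> by (simp add: A_def)
      qed
    qed
  qed
  have "(\<lambda>n. \<integral>\<omega>. indicator (A n) \<omega> \<partial>?\<nu>) \<longlonglongrightarrow> (\<integral>\<omega>. (1::real) \<partial>?\<nu>)"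
  proof (rule integral_dominated_convergence[where w = "\<lambda>_. 1"])
    show "AE \<omega> in ?\<nu>. (\<lambda>n. indicator (A n) \<omega> :: real) \<longlonglongrightarrow> 1"
      using ev by eventually_elim (auto intro!: tendsto_eventually elim!: eventually_mono)
  qed auto
  moreover have "(\<integral>\<omega>. indicator (A n) \<omega> \<partial>?\<nu>) = measure ?\<nu> (A n)" for n by simp
  ultimately show ?thesis unfolding A_def by (simp only: \<nu>.prob_space integral_const scaleR_one) (simp add: \<nu>.prob_space)
qed

text \<open>Up to a null set, a prefix with the Lipschitz bound is either good or has too small a
  sum of logarithms. The first kind of event has probability tending to 1 and the exceptional one
  tending to 0.\<close>

lemma good_words_weight_tendsto:
  assumes p: "prob_vector m p" and con: "contracts_on_average m f p lyap"
    and a: "lyap < a" and b: "b < h_vector m p"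
  shows "(\<lambda>n. \<Sum>w\<in>good_words m f p a b n. word_weight p w n) \<longlonglongrightarrow> 1"
proof -
  let ?\<nu> = "bernoulli_measure m p"
  interpret \<nu>: prob_space ?\<nu> by (rule prob_space_bernoulli_measure[OF p])
  let ?E = "\<lambda>n S. {\<omega> \<in> space ?\<nu>. restrict \<omega> {..<n} \<in> S}"
  let ?A = "\<lambda>n. {w \<in> words m n. lipschitz_norm (word_map f w n) \<le> exp (real n * a)}"
  let ?D = "\<lambda>n. {w \<in> words m n. (\<Sum>i<n. ln (p (w i))) \<le> real n * b}"
  let ?G = "\<lambda>n. good_words m f p a b n"
  have word: "restrict \<omega> {..<n} \<in> words m n" if "\<omega> \<in> space ?\<nu>" for \<omega> n
    using that by (intro restrict_in_words) (auto simp: space_bernoulli_measure)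
  have D: "(\<lambda>n. measure ?\<nu> (?E n (?D n))) \<longlonglongrightarrow> 0"
  proof -
    have "?E n (?D n) = {\<omega> \<in> space ?\<nu>. (\<Sum>i<n. ln (p (\<omega> i))) \<le> real n * b}" for n
      using word by (intro Collect_cong) (simp cong: conj_cong)
    then show ?thesis
      using bernoulli_measure_log_weight_deviation[OF p, of "h_vector m p - b"] b by simp
  qed
  have A: "(\<lambda>n. measure ?\<nu> (?E n (?A n))) \<longlonglongrightarrow> 1"
    by (rule contracts_on_average_prob_tendsto[OF p con a])
  \<comment> \<open>Since \<open>ln 0 = 0\<close>, the sum of logarithms is the logarithm of the
    weight only if all letters have positive probability; almost surely they do.\<close>
  have pos: "AE \<omega> in ?\<nu>. \<forall>i. p (\<omega> i) > 0"
  proof -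
    have "AE x in point_measure {1..m} (\<lambda>i. ennreal (p i)). p x > 0"
      by (subst AE_point_measure) auto
    then show ?thesis
      unfolding AE_all_countable bernoulli_measure_def
      by (intro allI AE_PiM_component prob_space_point_measure_vector[OF p]) auto
  qed
  have ge: "measure ?\<nu> (?E n (?A n)) - measure ?\<nu> (?E n (?D n)) \<le> (\<Sum>w\<in>?G n. word_weight p w n)" for n
  proof -
    have sets: "?E n (?A n) \<in> sets ?\<nu>" "?E n (?D n) \<in> sets ?\<nu>" "?E n (?G n) \<in> sets ?\<nu>"
      by (intro bernoulli_measure_word_event(1)[OF p]; auto simp: good_words_def)+
    have "AE \<omega> in ?\<nu>. \<omega> \<in> ?E n (?A n) \<longrightarrow> \<omega> \<in> ?E n (?G n) \<union> ?E n (?D n)"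
      using pos
    proof eventually_elim
      case (elim \<omega>)
      show ?case
      proof (intro impI, rule ccontr)
        assume \<omega>: "\<omega> \<in> ?E n (?A n)" and n: "\<omega> \<notin> ?E n (?G n) \<union> ?E n (?D n)"
        then have "(\<Sum>i<n. ln (p (restrict \<omega> {..<n} i))) > real n * b" by auto
        then have "exp (real n * b) \<le> exp (\<Sum>i<n. ln (p (\<omega> i)))" by simp
        also have "\<dots> = word_weight p (restrict \<omega> {..<n}) n"
          using elim by (simp add: exp_sum word_weight_def)
        finally show False using \<omega> n by (auto simp: good_words_def)
      qed
    qed
    then have "measure ?\<nu> (?E n (?A n)) \<le> measure ?\<nu> (?E n (?G n) \<union> ?E n (?D n))"
      using sets by (intro \<nu>.finite_measure_mono_AE) auto
    also have "\<dots> \<le> measure ?\<nu> (?E n (?G n)) + measure ?\<nu> (?E n (?D n))"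
      using sets by (intro measure_Un_le)
    also have "measure ?\<nu> (?E n (?G n)) = (\<Sum>w\<in>?G n. word_weight p w n)"
      by (rule bernoulli_measure_word_event(2)[OF p good_words_subset])
    finally show ?thesis by linarith
  qed
  have le: "(\<Sum>w\<in>?G n. word_weight p w n) \<le> 1" for n
    unfolding bernoulli_measure_word_event(2)[OF p good_words_subset, symmetric]
    by (rule \<nu>.prob_le_1)
  show ?thesis
  proof (rule tendsto_sandwich)
    show "(\<lambda>n. measure ?\<nu> (?E n (?A n)) - measure ?\<nu> (?E n (?D n))) \<longlonglongrightarrow> 1"
      using tendsto_diff[OF A D] by (simp only: diff_zero)
  qed (rule always_eventually allI ge le tendsto_const)+
qed

text \<open>Each good word weighs at least \<open>exp (real n * b)\<close>, and all of them together
  weigh at most 1.\<close>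

lemma card_good_words_le:
  assumes p: "prob_vector m p"
  shows "real (card (good_words m f p a b n)) * exp (real n * b) \<le> 1"
proof -
  let ?\<nu> = "bernoulli_measure m p"
  interpret \<nu>: prob_space ?\<nu> by (rule prob_space_bernoulli_measure[OF p])
  have "real (card (good_words m f p a b n)) * exp (real n * b) \<le>
      (\<Sum>w\<in>good_words m f p a b n. word_weight p w n)"
    by (intro sum_bounded_below) (auto simp: good_words_def)
  also have "\<dots> \<le> 1"
    unfolding bernoulli_measure_word_event(2)[OF p good_words_subset, symmetric]
    by (rule \<nu>.prob_le_1)
  finally show ?thesis .
qed

section \<open>Images of a ball under good words\<close>

definition good_images ::
  "nat \<Rightarrow> (nat \<Rightarrow> 'a::real_normed_vector \<Rightarrow> 'a) \<Rightarrow> (nat \<Rightarrow> real) \<Rightarrow> real \<Rightarrow> real \<Rightarrow> real \<Rightarrow> nat \<Rightarrow> 'a set"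
  where "good_images m f p a b R n = (\<Union>w\<in>good_words m f p a b n. word_map f w n ` cball 0 R)"

context
  fixes m :: nat and f :: "nat \<Rightarrow> 'a::euclidean_space \<Rightarrow> 'a" and p :: "nat \<Rightarrow> real"
  assumes lip: "\<And>i. i \<in> {1..m} \<Longrightarrow> lipschitz_map (f i)"
    and p: "prob_vector m p"
begin

lemma lipschitz_map_word: "w \<in> words m n \<Longrightarrow> lipschitz_map (word_map f w n)"
  by (intro lipschitz_map_word_map lip words_letter)

lemma good_word_dist_le:
  assumes "w \<in> good_words m f p a b n"
  shows "dist (word_map f w n x) (word_map f w n y) \<le> exp (real n * a) * dist x y"
proof -
  have "dist (word_map f w n x) (word_map f w n y) \<le> lipschitz_norm (word_map f w n) * dist x y"
    using lipschitz_norm_lipschitz_on[OF lipschitz_map_word] assms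
    by (auto simp: good_words_def lipschitz_on_def)
  also have "\<dots> \<le> exp (real n * a) * dist x y"
    using assms by (intro mult_right_mono) (auto simp: good_words_def)
  finally show ?thesis .
qed

lemma good_images_borel [measurable]: "good_images m f p a b R n \<in> sets borel"
  unfolding good_images_def
proof (intro borel_closed closed_UN ballI finite_good_words compact_imp_closed compact_continuous_image)
  fix w assume "w \<in> good_words m f p a b n"
  then show "continuous_on (cball 0 R) (word_map f w n)"
    using lipschitz_map_continuous_on[OF lipschitz_map_word]
    by (auto simp: good_words_def intro: continuous_on_subset)
qed simp

lemma word_map_vimage_borel:
  assumes "w \<in> words m n" "B \<in> sets borel"
  shows "word_map f w n -` B \<in> sets borel"
proof -
  have "word_map f w n \<in> borel_measurable borel"
    by (intro borel_measurable_continuous_onI lipschitz_map_continuous_on lipschitz_map_word assms)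
  from measurable_sets[OF this assms(2)] show ?thesis by simp
qed

text \<open>Iterated stationarity is applied to the union of images itself: its preimage under each
  good word contains the ball, and the remaining words are discarded.\<close>

lemma measure_good_images_ge:
  assumes st: "stationary_measure m f p \<mu>"
  shows "(\<Sum>w\<in>good_words m f p a b n. word_weight p w n) * measure \<mu> (cball 0 R)
    \<le> measure \<mu> (good_images m f p a b R n)"
proof -
  interpret \<mu>: prob_space \<mu> using st by (simp add: stationary_measure_def)
  have sets: "sets \<mu> = sets borel" using st by (simp add: stationary_measure_def)
  let ?T = "good_images m f p a b R n" and ?G = "good_words m f p a b n"
  have nn: "0 \<le> word_weight p w n" if "w \<in> ?G" for w
    using that word_weight_nonneg[OF p] good_words_subset by blast
  have "ennreal ((\<Sum>w\<in>?G. word_weight p w n) * measure \<mu> (cball 0 R)) =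
      (\<Sum>w\<in>?G. ennreal (word_weight p w n) * emeasure \<mu> (cball 0 R))"
    using nn by (simp add: \<mu>.emeasure_eq_measure sum_distrib_right[symmetric] ennreal_mult sum_nonneg)
  also have "\<dots> \<le> (\<Sum>w\<in>?G. ennreal (word_weight p w n) * emeasure \<mu> (word_map f w n -` ?T))"
  proof (intro sum_mono mult_left_mono emeasure_mono)
    fix w assume w: "w \<in> ?G"
    show "cball 0 R \<subseteq> word_map f w n -` ?T" using w by (auto simp: good_images_def)
    show "word_map f w n -` ?T \<in> sets \<mu>"
      unfolding sets using w
      by (intro word_map_vimage_borel good_images_borel subsetD[OF good_words_subset])
  qed simp
  also have "\<dots> \<le> (\<Sum>w\<in>words m n. ennreal (word_weight p w n) * emeasure \<mu> (word_map f w n -` ?T))"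
    by (intro sum_mono2 finite_words good_words_subset) simp
  also have "\<dots> = emeasure \<mu> ?T"
    by (rule stationary_measure_word_map[OF lip p st good_images_borel, symmetric])
  finally show ?thesis by (simp add: \<mu>.emeasure_eq_measure)
qed

text \<open>Each image lies in a ball of radius \<open>exp (real n * a) * R\<close>, and there are
  at most \<open>exp (- real n * b)\<close> good words. The bound is geometric in \<open>n\<close>,
  which prepares Borel-Cantelli.\<close>

lemma emeasure_lborel_good_images_le:
  assumes R: "0 \<le> R"
  shows "emeasure lborel (good_images m f p a b R n) \<le>
    ennreal (unit_ball_vol (real DIM('a)) * R ^ DIM('a) * exp (real DIM('a) * a - b) ^ n)"
proof -
  let ?G = "good_words m f p a b n"
  let ?V = "unit_ball_vol (real DIM('a))"
  have "emeasure lborel (good_images m f p a b R n) \<le>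
     emeasure lborel (\<Union>w\<in>?G. cball (word_map f w n 0) (exp (real n * a) * R))"
  proof (rule emeasure_mono)
    show "good_images m f p a b R n \<subseteq> (\<Union>w\<in>?G. cball (word_map f w n 0) (exp (real n * a) * R))"
      unfolding good_images_def
    proof (intro UN_mono subset_refl image_subsetI)
      fix w and x :: 'a assume "w \<in> ?G" "x \<in> cball 0 R"
      then have "dist (word_map f w n 0) (word_map f w n x) \<le> exp (real n * a) * dist 0 x"
        "dist 0 x \<le> R"
        using good_word_dist_le by (blast, simp)
      then show "word_map f w n x \<in> cball (word_map f w n 0) (exp (real n * a) * R)"
        by (auto intro: order_trans mult_left_mono)
    qed
  qed (auto intro!: sets.finite_UN)
  also have "\<dots> \<le> (\<Sum>w\<in>?G. emeasure lborel (cball (word_map f w n 0) (exp (real n * a) * R)))"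
    by (intro emeasure_subadditive_finite) auto
  also have "\<dots> = ennreal (real (card ?G) * (?V * (exp (real n * a) * R) ^ DIM('a)))"
    using R by (simp add: emeasure_cball ennreal_mult' ennreal_of_nat_eq_real_of_nat)
  also have "\<dots> \<le> ennreal (exp (- real n * b) * (?V * (exp (real n * a) * R) ^ DIM('a)))"
  proof (intro ennreal_leI mult_right_mono)
    show "real (card ?G) \<le> exp (- real n * b)"
      using card_good_words_le[OF p, of f a b n] by (simp add: exp_minus field_simps)
  qed (use R in auto)
  also have "exp (- real n * b) * (?V * (exp (real n * a) * R) ^ DIM('a)) =
      ?V * R ^ DIM('a) * exp (real DIM('a) * a - b) ^ n"
  proof -
    have "exp (- real n * b) * exp (real n * a) ^ DIM('a) = exp (real DIM('a) * a - b) ^ n"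
      by (simp add: exp_of_nat_mult[symmetric] exp_add[symmetric] algebra_simps)
    then show ?thesis by (simp add: power_mult_distrib mult_ac)
  qed
  finally show ?thesis .
qed

text \<open>Of the iterated stationarity identity for the small ball, only the term of a good word
  whose image contains \<open>x\<close> is kept.\<close>

lemma measure_ball_good_image_ge:
  assumes st: "stationary_measure m f p \<mu>" and R: "0 \<le> R"
    and x: "x \<in> good_images m f p a b R n"
  shows "exp (real n * b) * measure \<mu> (cball 0 R) \<le> measure \<mu> (ball x ((2 * R + 1) * exp (real n * a)))"
proof -
  interpret \<mu>: prob_space \<mu> using st by (simp add: stationary_measure_def)
  have sets: "sets \<mu> = sets borel" using st by (simp add: stationary_measure_def)
  let ?B = "ball x ((2 * R + 1) * exp (real n * a))"
  obtain w z where w: "w \<in> good_words m f p a b n" and z: "norm z \<le> R" and xz: "x = word_map f w n z"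
    using x by (auto simp: good_images_def)
  have ww: "w \<in> words m n" using w good_words_subset by blast
  have sub: "cball 0 R \<subseteq> word_map f w n -` ?B"
  proof
    fix y :: 'a assume "y \<in> cball 0 R"
    \<comment> \<open>Two points of the ball are at distance at most \<open>2 * R\<close>; the added
      1 makes the inequality strict, as the target ball is open, and keeps the radius positive for
      \<open>R = 0\<close>.\<close>
    then have "dist z y < 2 * R + 1"
      using z by (simp add: dist_norm) (smt (verit) norm_triangle_ineq4)
    then have "exp (real n * a) * dist z y < exp (real n * a) * (2 * R + 1)" by (rule mult_strict_left_mono) simp
    with good_word_dist_le[OF w, of z y]
    have "dist x (word_map f w n y) < exp (real n * a) * (2 * R + 1)" unfolding xz by linarith
    then show "y \<in> word_map f w n -` ?B"
      by (simp add: mult.commute)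
  qed
  have "ennreal (exp (real n * b) * measure \<mu> (cball 0 R)) =
      ennreal (exp (real n * b)) * emeasure \<mu> (cball 0 R)"
    by (simp add: \<mu>.emeasure_eq_measure ennreal_mult)
  also have "\<dots> \<le> ennreal (word_weight p w n) * emeasure \<mu> (word_map f w n -` ?B)"
    using w sub word_map_vimage_borel[OF ww, of ?B] sets
    by (intro mult_mono emeasure_mono ennreal_leI) (auto simp: good_words_def)
  also have "\<dots> \<le> (\<Sum>w\<in>words m n. ennreal (word_weight p w n) * emeasure \<mu> (word_map f w n -` ?B))"
    by (rule member_le_sum[OF ww]) auto
  also have "\<dots> = emeasure \<mu> ?B"
    by (rule stationary_measure_word_map[OF lip p st, symmetric]) (auto intro: borel_open)
  finally show ?thesis by (simp add: \<mu>.emeasure_eq_measure)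
qed

end

section \<open>Measurability and upper bounds of the lower local dimension\<close>

text \<open>An open ball is the increasing union of the open balls of smaller radii, so continuity
  from below applies.\<close>

lemma measure_ball_tendsto_at_left:
  fixes \<mu> :: "'a::metric_space measure"
  assumes "finite_measure \<mu>" and sets: "sets \<mu> = sets borel"
  shows "((\<lambda>s. measure \<mu> (ball x s)) \<longlongrightarrow> measure \<mu> (ball x r)) (at_left r)"
proof (rule tendsto_at_left_sequentially[of "r - 1"])
  interpret finite_measure \<mu> by fact
  fix S :: "nat \<Rightarrow> real"
  assume S: "\<And>n. S n < r" "incseq S" "S \<longlonglongrightarrow> r"
  have "(\<Union>n. ball x (S n)) = ball x r"
  proof (intro equalityI subsetI)
    fix y assume "y \<in> ball x r"
    then have "eventually (\<lambda>n. dist x y < S n) sequentially"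
      using S(3) by (intro order_tendstoD(1)) auto
    then show "y \<in> (\<Union>n. ball x (S n))" by (auto simp: eventually_sequentially)
  next
    fix y assume "y \<in> (\<Union>n. ball x (S n))"
    then show "y \<in> ball x r" using S(1) by (auto intro: less_trans)
  qed
  moreover have "(\<lambda>n. measure \<mu> (ball x (S n))) \<longlonglongrightarrow> measure \<mu> (\<Union>n. ball x (S n))"
    using S(2) by (intro finite_Lim_measure_incseq)
      (auto simp: sets incseq_def subset_ball intro: borel_open)
  ultimately show "(\<lambda>n. measure \<mu> (ball x (S n))) \<longlonglongrightarrow> measure \<mu> (ball x r)" by simp
qed simp

text \<open>Left continuity of \<open>r \<mapsto> \<mu>(B(x,r))\<close> lets the lower limit be computed along rational radii.
  Measurability is essential: \<^const>\<open>esssup\<close> of a non-measurable function is \<open>\<infinity>\<close>.\<close>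

lemma lower_local_dim_eq_rational:
  fixes \<mu> :: "'a::metric_space measure"
  assumes fin: "finite_measure \<mu>" and sets: "sets \<mu> = sets borel"
  shows "lower_local_dim \<mu> x =
    (SUP n. INF q\<in>{q \<in> \<rat>. 0 < q \<and> q < 1 / real (n + 2)}. elog (measure \<mu> (ball x q)) / ereal (ln q))"
    (is "_ = (SUP n. INF q\<in>?Q n. ?g q)")
  unfolding lower_local_dim_def
proof (rule antisym)
  show "Liminf (at_right 0) ?g \<le> (SUP n. INF q\<in>?Q n. ?g q)"
  proof (rule Liminf_least)
    fix P assume "eventually P (at_right (0::real))"
    then obtain d where d: "d > 0" "\<And>r. 0 < r \<Longrightarrow> r < d \<Longrightarrow> P r"
      by (auto simp: eventually_at_right_field)
    obtain n where "1 / real (Suc n) < d" using d(1) nat_approx_posE by blast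
    moreover have "1 / real (n + 2) \<le> 1 / real (Suc n)" by (simp add: field_simps)
    ultimately have "?Q n \<subseteq> Collect P" using d(2) by force
    then have "(INF r\<in>Collect P. ?g r) \<le> (INF q\<in>?Q n. ?g q)" by (rule INF_superset_mono) simp
    also have "\<dots> \<le> (SUP n. INF q\<in>?Q n. ?g q)" by (rule SUP_upper) simp
    finally show "(INF r\<in>Collect P. ?g r) \<le> (SUP n. INF q\<in>?Q n. ?g q)" .
  qed
  show "(SUP n. INF q\<in>?Q n. ?g q) \<le> Liminf (at_right 0) ?g"
  proof (rule SUP_least, rule Liminf_bounded)
    fix n
    have "(INF q\<in>?Q n. ?g q) \<le> ?g r" if r: "0 < r" "r < 1 / real (n + 2)" for r
    \<comment> \<open>If the quotient at \<open>r\<close> were below the infimum over rationals,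
      left continuity would keep it below at all radii slightly smaller than \<open>r\<close>, among
      them a rational one.\<close>
    proof (rule ccontr)
      assume less: "\<not> (INF q\<in>?Q n. ?g q) \<le> ?g r"
      \<comment> \<open>The cutoff \<open>1 / real (n + 2)\<close> keeps all radii below 1, where
        the logarithm is negative.\<close>
      have r1: "r < 1" using r(2) by (rule less_le_trans) simp
      then have lnr: "ln r < 0" using r by simp
      \<comment> \<open>A null ball gives minus infinity over a negative number, hence the quotient
        plus infinity, which is not below the infimum.\<close>
      have nz: "measure \<mu> (ball x r) \<noteq> 0"
      proof
        assume "measure \<mu> (ball x r) = 0"
        then have "?g r = \<infinity>" using lnr by (simp add: elog_def)
        then show False using less by simp
      qed
      have lim: "((\<lambda>s. measure \<mu> (ball x s)) \<longlongrightarrow> measure \<mu> (ball x r)) (at_left r)"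
        by (rule measure_ball_tendsto_at_left[OF fin sets])
      have "((\<lambda>s. ereal (ln (measure \<mu> (ball x s)) / ln s)) \<longlongrightarrow> ereal (ln (measure \<mu> (ball x r)) / ln r)) (at_left r)"
        using nz r lnr by (intro tendsto_intros lim) auto
      moreover have "\<forall>\<^sub>F s in at_left r. ereal (ln (measure \<mu> (ball x s)) / ln s) = ?g s"
      proof -
        have "\<forall>\<^sub>F s in at_left r. measure \<mu> (ball x s) > 0"
          using nz by (intro order_tendstoD(1)[OF lim]) (simp add: zero_less_measure_iff)
        moreover have "\<forall>\<^sub>F s in at_left r. s \<in> {0<..<r}"
          using r by (intro eventually_at_leftI[of 0]) auto
        ultimately show ?thesis
          by eventually_elim (use r1 in \<open>auto simp: elog_def\<close>)
      qed
      ultimately have "(?g \<longlongrightarrow> ereal (ln (measure \<mu> (ball x r)) / ln r)) (at_left r)"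
        by (rule Lim_transform_eventually)
      moreover have "ereal (ln (measure \<mu> (ball x r)) / ln r) = ?g r"
        using nz lnr by (simp add: elog_def)
      ultimately have "\<forall>\<^sub>F s in at_left r. ?g s < (INF q\<in>?Q n. ?g q)"
        using less by (intro order_tendstoD(2)) auto
      then obtain c where c: "c < r" "\<And>s. c < s \<Longrightarrow> s < r \<Longrightarrow> ?g s < (INF q\<in>?Q n. ?g q)"
        by (auto simp: eventually_at_left_field)
      obtain q where q: "q \<in> \<rat>" "max c 0 < q" "q < r"
        using Rats_dense_in_real[of "max c 0" r] c r by auto
      then have "(INF q\<in>?Q n. ?g q) \<le> ?g q" using r by (intro INF_lower) auto
      with c(2)[of q] q show False by simp
    qed
    then show "\<forall>\<^sub>F r in at_right 0. (INF q\<in>?Q n. ?g q) \<le> ?g r"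
      by (intro eventually_at_rightI[of 0 "1 / real (n + 2)"]) auto
  qed
qed

text \<open>A ball around \<open>x\<close> is the section at \<open>x\<close> of the open set of
  pairs at distance less than \<open>q\<close>, so its measure depends measurably on
  \<open>x\<close>. The rational formula then needs only countable suprema and infima.\<close>

lemma borel_measurable_lower_local_dim:
  fixes \<mu> :: "'a::{metric_space, second_countable_topology} measure"
  assumes fin: "finite_measure \<mu>" and sets: "sets \<mu> = sets borel"
  shows "lower_local_dim \<mu> \<in> borel_measurable borel"
proof -
  interpret finite_measure \<mu> by fact
  have meas: "(\<lambda>x. measure \<mu> (ball x q)) \<in> borel_measurable borel" for q
  proof -
    have "open {z :: 'a \<times> 'a. dist (fst z) (snd z) < q}"
      by (intro open_Collect_less continuous_intros)
    then have "{z :: 'a \<times> 'a. dist (fst z) (snd z) < q} \<in> sets (borel \<Otimes>\<^sub>M \<mu>)"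
      by (subst sets_pair_measure_cong[OF refl sets], subst borel_prod) (rule borel_open)
    from measurable_emeasure_Pair[OF this]
    have "(\<lambda>x. emeasure \<mu> (Pair x -` {z. dist (fst z) (snd z) < q})) \<in> borel_measurable borel" .
    moreover have "Pair x -` {z. dist (fst z) (snd z) < q} = ball x q" for x :: 'a
      by auto
    ultimately show ?thesis unfolding measure_def by simp
  qed
  have elog: "elog \<in> borel_measurable borel"
    unfolding elog_def by measurable
  have "(\<lambda>x. elog (measure \<mu> (ball x q)) / ereal (ln q)) \<in> borel_measurable borel" for q
    by (intro borel_measurable_ereal_divide measurable_compose[OF meas elog]) simp
  then have "(\<lambda>x. SUP n. INF q\<in>{q \<in> \<rat>. 0 < q \<and> q < 1 / real (n + 2)}.
      elog (measure \<mu> (ball x q)) / ereal (ln q)) \<in> borel_measurable borel"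
    by (intro borel_measurable_SUP borel_measurable_INF)
       (auto intro: countable_subset[OF _ countable_rat])
  then show ?thesis
    by (simp add: lower_local_dim_eq_rational[OF fin sets, abs_def])
qed

text \<open>Along the radii \<open>K * exp (real n * a)\<close>, which tend to 0, the quotient is
  infinitely often at most \<open>(n * b + ln c) / (n * a + ln K)\<close>, which tends to
  \<open>b / a\<close>. A lower limit cannot exceed this.\<close>

lemma lower_local_dim_le_of_frequently:
  assumes a: "a < 0" and c: "c > 0" and K: "K > 0"
    and freq: "\<exists>\<^sub>F n in sequentially. exp (real n * b) * c \<le> measure \<mu> (ball x (K * exp (real n * a)))"
  shows "lower_local_dim \<mu> x \<le> ereal (b / a)"
proof (rule ccontr)
  let ?g = "\<lambda>r. elog (measure \<mu> (ball x r)) / ereal (ln r)"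
  let ?r = "\<lambda>n. K * exp (real n * a)"
  assume "\<not> lower_local_dim \<mu> x \<le> ereal (b / a)"
  then obtain y where y: "ereal (b / a) < y" "y < lower_local_dim \<mu> x"
    using dense not_le by metis
  from y(2) have ev: "\<forall>\<^sub>F r in at_right 0. y < ?g r"
    unfolding lower_local_dim_def by (rule less_LiminfD)
  have "(\<lambda>n. exp a ^ n) \<longlonglongrightarrow> 0"
    using a by (intro LIMSEQ_power_zero) auto
  then have r0: "?r \<longlonglongrightarrow> 0"
    by (auto intro!: tendsto_mult_right_zero simp: exp_of_nat_mult)
  then have "filterlim ?r (at_right 0) sequentially"
    using K by (auto simp: filterlim_at)
  from eventually_compose_filterlim[OF ev this]
  have g: "\<forall>\<^sub>F n in sequentially. y < ?g (?r n)" .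
  have r1: "\<forall>\<^sub>F n in sequentially. ?r n < 1"
    by (rule order_tendstoD(2)[OF r0]) simp
  have "(\<lambda>n. (b + ln c / real n) / (a + ln K / real n)) \<longlonglongrightarrow> (b + 0) / (a + 0)"
    using a by (intro tendsto_intros lim_const_over_n) auto
  then have "(\<lambda>n. ereal ((b + ln c / real n) / (a + ln K / real n))) \<longlonglongrightarrow> ereal (b / a)"
    by simp
  then have lim: "\<forall>\<^sub>F n in sequentially. ereal ((b + ln c / real n) / (a + ln K / real n)) < y"
    using y(1) by (rule order_tendstoD(2))
  have "\<exists>\<^sub>F n in sequentially. False"
  proof (rule frequently_rev_mp[OF freq])
    show "\<forall>\<^sub>F n in sequentially. exp (real n * b) * c \<le> measure \<mu> (ball x (?r n)) \<longrightarrow> False"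
      using g r1 lim eventually_gt_at_top[of 0]
    proof eventually_elim
      case (elim n)
      show ?case
      proof
        assume le: "exp (real n * b) * c \<le> measure \<mu> (ball x (?r n))"
        have pos: "0 < exp (real n * b) * c" using c by simp
        then have mpos: "measure \<mu> (ball x (?r n)) > 0" using le by linarith
        have lnr: "ln (?r n) = real n * a + ln K" using K by (simp add: ln_mult)
        have neg: "real n * a + ln K < 0"
          using elim(2) K by (simp flip: lnr)
        have "real n * b + ln c \<le> ln (measure \<mu> (ball x (?r n)))"
          using le pos mpos c by (simp add: ln_mult flip: ln_le_cancel_iff)
        \<comment> \<open>The radius is below 1, so division by its negative logarithm turns the
          lower bound on the measure into an upper bound.\<close>
        then have "ln (measure \<mu> (ball x (?r n))) / ln (?r n) \<le> (real n * b + ln c) / (real n * a + ln K)"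
          unfolding lnr using neg by (intro divide_right_mono_neg) auto
        also have "\<dots> = (b + ln c / real n) / (a + ln K / real n)"
        proof -
          have "real n * b + ln c = real n * (b + ln c / real n)"
            "real n * a + ln K = real n * (a + ln K / real n)"
            using elim(4) by (simp_all add: field_simps)
          then show ?thesis using elim(4) by simp
        qed
        finally have "ereal (ln (measure \<mu> (ball x (?r n))) / ln (?r n)) \<le>
          ereal ((b + ln c / real n) / (a + ln K / real n))" by (simp only: ereal_less_eq)
        then have "ereal (ln (measure \<mu> (ball x (?r n))) / ln (?r n)) < y"
          using elim(3) by (rule le_less_trans)
        moreover have "?g (?r n) = ereal (ln (measure \<mu> (ball x (?r n))) / ln (?r n))"
          unfolding elog_def using mpos neg lnr by (simp del: ereal_less_eq)
        ultimately show False using elim(1) by (metis less_asym)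
      qed
    qed
  qed
  then show False by simp
qed

section \<open>Limsup sets of good images\<close>

text \<open>The limsup set is the decreasing intersection of the tail unions. Each tail union has
  measure at least \<open>L\<close>, and continuity from above passes this to the
  intersection.\<close>

lemma measure_frequently_ge:
  assumes "finite_measure M" and A: "\<And>n. A n \<in> sets M"
    and le: "\<And>n. c n \<le> measure M (A n)" and c: "c \<longlonglongrightarrow> L"
  shows "L \<le> measure M {x \<in> space M. \<exists>\<^sub>F n in sequentially. x \<in> A n}"
proof -
  interpret finite_measure M by fact
  have eq: "{x \<in> space M. \<exists>\<^sub>F n in sequentially. x \<in> A n} = (\<Inter>N. \<Union>n\<in>{N..}. A n)"
    using sets.sets_into_space[OF A] by (fastforce simp: frequently_sequentially)
  have "L \<le> measure M (\<Union>n\<in>{N..}. A n)" for N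
  proof (rule LIMSEQ_le_const2[OF c], intro exI allI impI)
    fix n assume "N \<le> n"
    then have "measure M (A n) \<le> measure M (\<Union>n\<in>{N..}. A n)"
      using A by (intro finite_measure_mono) auto
    with le[of n] show "c n \<le> measure M (\<Union>n\<in>{N..}. A n)" by linarith
  qed
  moreover have "(\<lambda>N. measure M (\<Union>n\<in>{N..}. A n)) \<longlonglongrightarrow> measure M (\<Inter>N. \<Union>n\<in>{N..}. A n)"
    using A by (intro finite_Lim_measure_decseq) (auto simp: decseq_def intro: order_trans)
  ultimately show ?thesis
    unfolding eq by (intro LIMSEQ_le_const) auto
qed

text \<open>For fixed \<open>R\<close> the limsup set has measure at least that of the ball of
  radius \<open>R\<close>; letting \<open>R\<close> grow through the integers exhausts the whole
  mass.\<close>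

lemma AE_frequently_good_images:
  fixes f :: "nat \<Rightarrow> 'a::euclidean_space \<Rightarrow> 'a"
  assumes lip: "\<And>i. i \<in> {1..m} \<Longrightarrow> lipschitz_map (f i)"
    and p: "prob_vector m p"
    and con: "contracts_on_average m f p lyap"
    and st: "stationary_measure m f p \<mu>"
    and a: "lyap < a" and b: "b < h_vector m p"
  shows "AE x in \<mu>. \<exists>R. measure \<mu> (cball 0 (real R)) > 0 \<and>
    (\<exists>\<^sub>F n in sequentially. x \<in> good_images m f p a b (real R) n)"
proof -
  interpret \<mu>: prob_space \<mu> using st by (simp add: stationary_measure_def)
  have sets: "sets \<mu> = sets borel" using st by (simp add: stationary_measure_def)
  have space: "space \<mu> = UNIV" using sets_eq_imp_space_eq[OF sets] by simp
  have T: "good_images m f p a b R n \<in> sets \<mu>" for R n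
    unfolding sets by (rule good_images_borel[OF lip p])
  define L where "L R = {x \<in> space \<mu>. \<exists>\<^sub>F n in sequentially. x \<in> good_images m f p a b (real R) n}" for R
  have L_sets [measurable]: "L R \<in> sets \<mu>" for R
    unfolding L_def frequently_sequentially using T by measurable
  define U where "U = (\<Union>R\<in>{R. measure \<mu> (cball 0 (real R)) > 0}. L R)"
  have U [measurable]: "U \<in> sets \<mu>" unfolding U_def by measurable
  have "measure \<mu> (cball 0 (real R)) \<le> measure \<mu> U" for R
  proof (cases "measure \<mu> (cball 0 (real R)) > 0")
    case True
    have "(\<lambda>n. (\<Sum>w\<in>good_words m f p a b n. word_weight p w n) * measure \<mu> (cball 0 (real R)))
        \<longlonglongrightarrow> 1 * measure \<mu> (cball 0 (real R))"
      by (intro tendsto_intros good_words_weight_tendsto[OF p con a b])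
    from measure_frequently_ge[OF \<mu>.finite_measure_axioms T measure_good_images_ge[OF lip p st] this]
    have "measure \<mu> (cball 0 (real R)) \<le> measure \<mu> (L R)" by (simp add: L_def)
    also have "\<dots> \<le> measure \<mu> U"
      using True by (intro \<mu>.finite_measure_mono U) (auto simp: U_def)
    finally show ?thesis .
  next
    case False
    then have "measure \<mu> (cball 0 (real R)) \<le> 0" by simp
    then show ?thesis using measure_nonneg[of \<mu> U] by linarith
  qed
  moreover have "(\<lambda>R. measure \<mu> (cball 0 (real R))) \<longlonglongrightarrow> measure \<mu> (\<Union>R. cball 0 (real R))"
    by (intro \<mu>.finite_Lim_measure_incseq) (auto simp: sets incseq_def intro: borel_closed)
  moreover have "(\<Union>R. cball 0 (real R)) = (UNIV :: 'a set)"
    using real_arch_simple by auto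
  ultimately have "1 \<le> measure \<mu> U"
    using \<mu>.prob_space by (intro LIMSEQ_le_const2) (auto simp: space)
  then have "\<mu>.prob U = 1" using \<mu>.prob_le_1[of U] by linarith
  then have "AE x in \<mu>. x \<in> U" by (rule \<mu>.AE_prob_1)
  then show ?thesis by eventually_elim (auto simp: U_def L_def)
qed

text \<open>The Lebesgue measures are dominated by a geometric series of ratio
  \<open>exp (real DIM('a) * a - b) < 1\<close>, so Borel-Cantelli applies.\<close>

lemma AE_lborel_eventually_notin_good_images:
  fixes f :: "nat \<Rightarrow> 'a::euclidean_space \<Rightarrow> 'a"
  assumes lip: "\<And>i. i \<in> {1..m} \<Longrightarrow> lipschitz_map (f i)"
    and p: "prob_vector m p" and R: "0 \<le> R"
    and ab: "real DIM('a) * a < b"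
  shows "AE x in lborel. eventually (\<lambda>n. x \<notin> good_images m f p a b R n) sequentially"
proof -
  let ?T = "good_images m f p a b R"
  let ?B = "\<lambda>n. unit_ball_vol (real DIM('a)) * R ^ DIM('a) * exp (real DIM('a) * a - b) ^ n"
  have le: "emeasure lborel (?T n) \<le> ennreal (?B n)" for n
    by (rule emeasure_lborel_good_images_le[OF lip p R])
  have nn: "0 \<le> ?B n" for n using R by simp
  have fin: "emeasure lborel (?T n) < \<infinity>" for n
    using le[of n] by (rule le_less_trans) simp
  have "summable ?B" using ab by (intro summable_mult summable_geometric) simp
  then have "summable (\<lambda>n. measure lborel (?T n))"
  proof (rule summable_comparison_test'[where N = 0])
    fix n show "norm (measure lborel (?T n)) \<le> ?B n"
      using enn2real_mono[OF le[of n]] nn[of n] by (simp add: measure_def)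
  qed
  from borel_cantelli_AE1[OF _ fin this] show ?thesis
    using good_images_borel[OF lip p] by simp
qed

theorem corollary2p4:
  fixes m :: nat
    and f :: "nat \<Rightarrow> real ^ 'd \<Rightarrow> real ^ 'd"
    and p :: "nat \<Rightarrow> real"
    and lyap :: real
    and \<mu> :: "(real ^ 'd) measure"
  assumes "\<And>i. i \<in> {1..m} \<Longrightarrow> lipschitz_map (f i)"
    and "prob_vector m p"
    and "contracts_on_average m f p lyap"
    and "stationary_measure m f p \<mu>"
    and "real CARD('d) * \<bar>lyap\<bar> > \<bar>h_vector m p\<bar>"
  shows "mutually_singular \<mu> lborel
    \<and> dim_H \<mu> \<le> ereal (h_vector m p / lyap)
    \<and> h_vector m p / lyap < real CARD('d)"
proof (intro conjI)
  note lip = assms(1) and p = assms(2) and con = assms(3) and st = assms(4)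
  let ?h = "h_vector m p" and ?D = "real CARD('d)"
  interpret \<mu>: prob_space \<mu> using st by (simp add: stationary_measure_def)
  have sets: "sets \<mu> = sets borel" using st by (simp add: stationary_measure_def)
  have space: "space \<mu> = UNIV" using sets_eq_imp_space_eq[OF sets] by simp
  have lyap: "lyap < 0" using con by (simp add: contracts_on_average_def)
  have h: "?h \<le> 0" by (rule h_vector_nonpos[OF p])
  have gap: "?D * lyap < ?h" using assms(5) lyap h by simp
  then show "?h / lyap < ?D" using lyap by (simp add: field_simps)

  show "mutually_singular \<mu> lborel"
  proof -
    \<comment> \<open>Summability requires \<open>?D * (lyap + e) < ?h - e\<close>, that is
      \<open>(?D + 1) * e < ?h - ?D * lyap\<close>; this \<open>e\<close> uses half of the
      gap.\<close>
    define e where "e = (?h - ?D * lyap) / (2 * (?D + 1))"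
    have e: "e > 0" unfolding e_def using gap by simp
    have "(?D + 1) * e = (?h - ?D * lyap) / 2" by (simp add: e_def field_simps)
    then have small: "?D * (lyap + e) < ?h - e" using gap by (simp add: algebra_simps)
    define T where "T R = good_images m f p (lyap + e) (?h - e) (real R)" for R :: nat
    have T: "T R n \<in> sets borel" for R n unfolding T_def by (rule good_images_borel[OF lip p])
    \<comment> \<open>The separating set is the complement of all limsup sets:
      \<open>\<mu>\<close>-null, yet of full Lebesgue measure.\<close>
    define A where "A = {x. \<forall>R. \<forall>\<^sub>F n in sequentially. x \<notin> T R n}"
    have A: "A \<in> sets borel" unfolding A_def eventually_sequentially using T by measurable
    have "AE x in \<mu>. x \<notin> A"
      using AE_frequently_good_images[OF lip p con st, of "lyap + e" "?h - e"] e
      by (auto simp: A_def T_def frequently_def elim!: eventually_mono)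
    then have "emeasure \<mu> A = 0"
      using A sets by (subst (asm) AE_iff_measurable[of A]) (auto simp: space)
    moreover have "AE x in lborel. x \<in> A"
      unfolding A_def mem_Collect_eq AE_all_countable T_def
      using small by (intro allI AE_lborel_eventually_notin_good_images lip p) auto
    then have "emeasure lborel (space lborel - A) = 0"
      using A by (subst (asm) AE_iff_measurable[of "- A"]) (auto simp: Compl_eq_Diff_UNIV)
    ultimately show ?thesis
      using A sets by (auto simp: mutually_singular_def)
  qed

  \<comment> \<open>The condition \<open>e < - lyap\<close> keeps \<open>lyap + e\<close> negative,
    so the radii still shrink to 0. Letting \<open>e\<close> tend to 0 from above then gives the
    sharp bound.\<close>
  have bound: "dim_H \<mu> \<le> ereal ((?h - e) / (lyap + e))" if e: "0 < e" "e < - lyap" for e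
    unfolding dim_H_def
  proof (rule esssup_I)
    show "lower_local_dim \<mu> \<in> borel_measurable \<mu>"
      using borel_measurable_lower_local_dim[OF \<mu>.finite_measure_axioms sets]
      by (simp add: measurable_cong_sets[OF sets refl])
    have "AE x in \<mu>. \<exists>R. measure \<mu> (cball 0 (real R)) > 0 \<and>
        (\<exists>\<^sub>F n in sequentially. x \<in> good_images m f p (lyap + e) (?h - e) (real R) n)"
      using e by (intro AE_frequently_good_images[OF lip p con st]) auto
    then show "AE x in \<mu>. lower_local_dim \<mu> x \<le> ereal ((?h - e) / (lyap + e))"
    proof eventually_elim
      case (elim x)
      then obtain R :: nat where R: "measure \<mu> (cball 0 (real R)) > 0"
        "\<exists>\<^sub>F n in sequentially. x \<in> good_images m f p (lyap + e) (?h - e) (real R) n" by blast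
      show ?case
      proof (rule lower_local_dim_le_of_frequently)
        show "\<exists>\<^sub>F n in sequentially. exp (real n * (?h - e)) * measure \<mu> (cball 0 (real R))
            \<le> measure \<mu> (ball x ((2 * real R + 1) * exp (real n * (lyap + e))))"
          using R(2) by (rule frequently_elim1) (rule measure_ball_good_image_ge[OF lip p st], auto)
      qed (use e R in auto)
    qed
  qed
  show "dim_H \<mu> \<le> ereal (?h / lyap)"
  proof (rule tendsto_lowerbound)
    have "((\<lambda>e. (?h - e) / (lyap + e)) \<longlongrightarrow> (?h - 0) / (lyap + 0)) (at_right 0)"
      using lyap by (intro tendsto_intros) auto
    then show "((\<lambda>e. ereal ((?h - e) / (lyap + e))) \<longlongrightarrow> ereal (?h / lyap)) (at_right 0)" by simp
    show "\<forall>\<^sub>F e in at_right 0. dim_H \<mu> \<le> ereal ((?h - e) / (lyap + e))"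
      using bound lyap by (intro eventually_at_rightI[of 0 "- lyap"]) auto
  qed simp
qed

end
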